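(* A ternary groupoid $(A,[\,])$ is a knot-theoretic ternary group if and only if it is entropic and there exists on $A$ a unary operation $x\mapsto\bar x$ such that for all $a,b,x\in A$ $$[\bar a a x]=[x a\bar a]=x\qquad\text{and}\qquad [abb]=\bar a.$$
   Context: A ternary groupoid $(A,[\,])$ is a non-empty set $A$ with a ternary operation $[\,]\colon A^3\to A$. It is a ternary quasigroup if for all $a,b,c\in A$ each of the equations $[zab]=c$, $[azb]=c$, $[abz]=c$ has a unique solution $z\in A$. A ternary group is a ternary quasigroup that is associative: $[[abc]de]=[a[bcd]e]=[ab[cde]]$ for all $a,b,c,d,e\in A$. A knot-theoretic ternary group is a ternary group such that, for all $a,b,c,d\in A$, $[[abc]cd]=[[ab[bcd]][bcd]d]$ and $[ab[bcd]]=[a[abc][[abc]cd]]$. A ternary groupoid is entropic if $[[a_1a_2a_3][b_1b_2b_3][c_1c_2c_3]]=[[a_1b_1c_1][a_2b_2c_2][a_3b_3c_3]]$ for all $a_1,a_2,a_3,b_1,b_2,b_3,c_1,c_2,c_3\in A$. *)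

theory Defs
  imports Main
begin

locale ternary_groupoid =
  fixes A :: "'a set" and t :: "'a \<Rightarrow> 'a \<Rightarrow> 'a \<Rightarrow> 'a"
  assumes nonempty: "A \<noteq> {}"
    and closed: "\<lbrakk>a \<in> A; b \<in> A; c \<in> A\<rbrakk> \<Longrightarrow> t a b c \<in> A"

locale ternary_quasigroup = ternary_groupoid +
  assumes unique_solution_left: "\<lbrakk>a \<in> A; b \<in> A; c \<in> A\<rbrakk> \<Longrightarrow> \<exists>!z. z \<in> A \<and> t z a b = c"
    and unique_solution_middle: "\<lbrakk>a \<in> A; b \<in> A; c \<in> A\<rbrakk> \<Longrightarrow> \<exists>!z. z \<in> A \<and> t a z b = c"
    and unique_solution_right: "\<lbrakk>a \<in> A; b \<in> A; c \<in> A\<rbrakk> \<Longrightarrow> \<exists>!z. z \<in> A \<and> t a b z = c"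

locale ternary_group = ternary_quasigroup +
  assumes assoc_left_middle:
      "\<lbrakk>a \<in> A; b \<in> A; c \<in> A; d \<in> A; e \<in> A\<rbrakk> \<Longrightarrow> t (t a b c) d e = t a (t b c d) e"
    and assoc_middle_right:
      "\<lbrakk>a \<in> A; b \<in> A; c \<in> A; d \<in> A; e \<in> A\<rbrakk> \<Longrightarrow> t a (t b c d) e = t a b (t c d e)"

locale knot_theoretic_ternary_group = ternary_group +
  assumes knot_left:
      "\<lbrakk>a \<in> A; b \<in> A; c \<in> A; d \<in> A\<rbrakk> \<Longrightarrow>
        t (t a b c) c d = t (t a b (t b c d)) (t b c d) d"
    and knot_right:
      "\<lbrakk>a \<in> A; b \<in> A; c \<in> A; d \<in> A\<rbrakk> \<Longrightarrow>
        t a b (t b c d) = t a (t a b c) (t (t a b c) c d)"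

locale entropic_ternary_groupoid = ternary_groupoid +
  assumes entropic:
      "\<lbrakk>a1 \<in> A; a2 \<in> A; a3 \<in> A; b1 \<in> A; b2 \<in> A; b3 \<in> A; c1 \<in> A; c2 \<in> A; c3 \<in> A\<rbrakk> \<Longrightarrow>
        t (t a1 a2 a3) (t b1 b2 b3) (t c1 c2 c3) = t (t a1 b1 c1) (t a2 b2 c2) (t a3 b3 c3)"

end

(* In a ternary group the two knot identities cancel to [abb] = [ayy] and [ccd] = [yyd]; taking y to
   be the skew element of a (the solution of [s a a] = a) shows that [abb] is skew to a. Comparing
   [[abc][cba]x] and [[abc][abc]x] then gives [abc] = [cba], which together with associativity
   yields entropicity.
   Conversely, since x = [x u u'] = [u' u x] with u' the skew element of u, any product can be
   written as a 3 x 3 array, and transposing arrays gives associativity and [abc] = [cba]. *)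
theory Submission
  imports Defs
begin

context ternary_group
begin

lemma cancel_left: "\<lbrakk>t x a b = t y a b; x \<in> A; y \<in> A; a \<in> A; b \<in> A\<rbrakk> \<Longrightarrow> x = y"
  using unique_solution_left[of a b "t y a b"] closed by blast

lemma cancel_middle: "\<lbrakk>t a x b = t a y b; x \<in> A; y \<in> A; a \<in> A; b \<in> A\<rbrakk> \<Longrightarrow> x = y"
  using unique_solution_middle[of a b "t a y b"] closed by blast

lemma cancel_right: "\<lbrakk>t a b x = t a b y; x \<in> A; y \<in> A; a \<in> A; b \<in> A\<rbrakk> \<Longrightarrow> x = y"
  using unique_solution_right[of a b "t a b y"] closed by blast

lemma assoc_left_right:
  "\<lbrakk>a \<in> A; b \<in> A; c \<in> A; d \<in> A; e \<in> A\<rbrakk> \<Longrightarrow> t (t a b c) d e = t a b (t c d e)"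
  by (simp add: assoc_left_middle assoc_middle_right)

text \<open>The solution \<open>s\<close> of \<open>t s a a = a\<close> is neutral beside
  \<open>a\<close> in one product only. Since every \<open>x\<close> has the form
  \<open>t a a w\<close>, associativity spreads this to all \<open>x\<close>; the other two laws
  follow by cancelling \<open>a\<close>, \<open>a\<close> on the right or by the same
  factorisation.\<close>

lemma skew_exists:
  assumes a: "a \<in> A"
  obtains s where "s \<in> A" "\<And>x. x \<in> A \<Longrightarrow> t s a x = x" "\<And>x. x \<in> A \<Longrightarrow> t x a s = x"
    "\<And>x. x \<in> A \<Longrightarrow> t a s x = x"
proof -
  obtain s where s: "s \<in> A" "t s a a = a"
    using unique_solution_left a by blast
  have left: "t s a x = x" if x: "x \<in> A" for x
  proof -
    obtain w where "w \<in> A" "x = t a a w"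
      using unique_solution_right a x by metis
    then show ?thesis
      using assoc_left_right[of s a a a w] a s by simp
  qed
  have right: "t x a s = x" if x: "x \<in> A" for x
  proof (rule cancel_left)
    show "t (t x a s) a a = t x a a"
      using assoc_left_right[of x a s a a] a s x by simp
  qed (use a s x closed in auto)
  have asa: "t a s a = a"
  proof (rule cancel_left)
    show "t (t a s a) a a = t a a a"
      using assoc_left_middle[of a s a a a] a s by simp
  qed (use a s closed in auto)
  have mid: "t a s x = x" if x: "x \<in> A" for x
  proof -
    obtain w where "w \<in> A" "x = t a a w"
      using unique_solution_right a x by metis
    then show ?thesis
      using assoc_left_right[of a s a a w] a s asa by simp
  qed
  show ?thesis
    using that s(1) left right mid by blast
qed

text \<open>Associativity flattens either side to a word of nine letters, in which semicommutativity
  swaps letters two places apart. Reading the array by rows or by columns gives each letter a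
  position of the same parity, so such swaps suffice.\<close>

lemma entropic_if_semicommutative:
  assumes semicomm: "\<And>a b c. \<lbrakk>a \<in> A; b \<in> A; c \<in> A\<rbrakk> \<Longrightarrow> t a b c = t c b a"
  shows "entropic_ternary_groupoid A t"
proof unfold_locales
  have comm: "t a b (t c d e) = t c b (t a d e)"
    if "a \<in> A" "b \<in> A" "c \<in> A" "d \<in> A" "e \<in> A" for a b c d e
    using that assoc_left_right[of a b c d e] assoc_left_right[of c b a d e] semicomm[of a b c] by simp
  have comm': "t a b (t c d e) = t a d (t c b e)"
    if "a \<in> A" "b \<in> A" "c \<in> A" "d \<in> A" "e \<in> A" for a b c d e
    using that assoc_middle_right[of a b c d e] assoc_middle_right[of a d c b e] semicomm[of b c d] by simp
  fix a1 a2 a3 b1 b2 b3 c1 c2 c3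
  assume A: "a1 \<in> A" "a2 \<in> A" "a3 \<in> A" "b1 \<in> A" "b2 \<in> A" "b3 \<in> A" "c1 \<in> A" "c2 \<in> A" "c3 \<in> A"
  have expand: "t (t a1 a2 a3) (t b1 b2 b3) (t c1 c2 c3) = t a1 a2 (t a3 b1 (t b2 b3 (t c1 c2 c3)))"
    if "a1 \<in> A" "a2 \<in> A" "a3 \<in> A" "b1 \<in> A" "b2 \<in> A" "b3 \<in> A" "c1 \<in> A" "c2 \<in> A" "c3 \<in> A"
    for a1 a2 a3 b1 b2 b3 c1 c2 c3
    using that by (simp add: assoc_left_right assoc_middle_right closed)
  have "t a1 a2 (t a3 b1 (t b2 b3 (t c1 c2 c3))) = t a1 b1 (t a3 a2 (t b2 b3 (t c1 c2 c3)))"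
    using A by (simp add: comm' closed)
  also have "\<dots> = t a1 b1 (t a3 a2 (t c1 b3 (t b2 c2 c3)))"
    using A by (simp add: comm[of b2 b3 c1])
  also have "\<dots> = t a1 b1 (t c1 a2 (t a3 b3 (t b2 c2 c3)))"
    using A by (simp add: comm[of a3 a2 c1] closed)
  also have "\<dots> = t a1 b1 (t c1 a2 (t b2 b3 (t a3 c2 c3)))"
    using A by (simp add: comm[of a3 b3 b2])
  also have "\<dots> = t a1 b1 (t c1 a2 (t b2 c2 (t a3 b3 c3)))"
    using A by (simp add: comm'[of b2 b3 a3 c2])
  finally show "t (t a1 a2 a3) (t b1 b2 b3) (t c1 c2 c3) = t (t a1 b1 c1) (t a2 b2 c2) (t a3 b3 c3)"
    using A by (simp add: expand)
qed

end

context knot_theoretic_ternary_group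
begin

text \<open>If \<open>y = t a b c\<close>, regrouping \<open>knot_right\<close> gives
  \<open>t (t a b b) c d = t (t a y y) c d\<close>, where \<open>c\<close>, \<open>d\<close> cancel.
  Solvability makes \<open>y\<close> arbitrary.\<close>

lemma right_square_const:
  assumes A: "a \<in> A" "b \<in> A" "y \<in> A"
  shows "t a b b = t a y y"
proof -
  obtain c where c: "c \<in> A" "t a b c = y"
    using unique_solution_right A by blast
  show ?thesis
  proof (rule cancel_left)
    show "t (t a b b) c a = t (t a y y) c a"
      using knot_right[of a b c a] A c by (simp add: assoc_left_right)
  qed (use A c closed in auto)
qed

lemma left_square_const:
  assumes A: "c \<in> A" "d \<in> A" "y \<in> A"
  shows "t c c d = t y y d"
proof -
  obtain b where b: "b \<in> A" "t b c d = y"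
    using unique_solution_left A by blast
  show ?thesis
  proof (rule cancel_right)
    show "t d b (t c c d) = t d b (t y y d)"
      using knot_left[of d b c d] A b by (simp add: assoc_left_right)
  qed (use A b closed in auto)
qed

lemma square_skew:
  assumes A: "a \<in> A" "b \<in> A" "x \<in> A"
  shows "t (t a b b) a x = x" "t x a (t a b b) = x" "t a (t a b b) x = x"
proof -
  obtain s where s: "s \<in> A" "\<And>x. x \<in> A \<Longrightarrow> t s a x = x" "\<And>x. x \<in> A \<Longrightarrow> t x a s = x"
      "\<And>x. x \<in> A \<Longrightarrow> t a s x = x"
    using skew_exists A by metis
  \<comment> \<open>Replace \<open>b\<close> by \<open>s\<close>: the square becomes
    \<open>t a s s\<close>, and \<open>t a s\<close> acts as the identity on
    \<open>s\<close>.\<close>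
  have "t a b b = s"
    using right_square_const[of a b s] A s by simp
  then show "t (t a b b) a x = x" "t x a (t a b b) = x" "t a (t a b b) x = x"
    using A s by simp_all
qed

text \<open>Both \<open>t (t a b c) (t c b a) a\<close> and \<open>t (t a b c) (t a b c) a\<close>
  equal \<open>t a a a\<close>: in the first the letters collapse from the inside, the second is a
  left square. The middle factor is then determined.\<close>

lemma semicommutative:
  assumes A: "a \<in> A" "b \<in> A" "c \<in> A"
  shows "t a b c = t c b a"
proof -
  have "t (t a b c) (t c b a) a = t a (t b (t c c b) a) a"
    using A by (simp add: assoc_left_middle assoc_middle_right closed)
  also have "t c c b = t b b b"
    by (rule left_square_const) (use A in auto)
  also have "t b (t b b b) a = a"
    using square_skew(3) A by simp
  also have "t a a a = t (t a b c) (t a b c) a"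
    by (rule left_square_const) (use A closed in auto)
  finally have "t (t a b c) (t a b c) a = t (t a b c) (t c b a) a" ..
  then show ?thesis
    by (rule cancel_middle) (use A closed in auto)
qed

end

locale skew_entropic_ternary_groupoid = entropic_ternary_groupoid +
  fixes bar :: "'a \<Rightarrow> 'a"
  assumes bar_closed: "a \<in> A \<Longrightarrow> bar a \<in> A"
    and bar_left: "\<lbrakk>a \<in> A; x \<in> A\<rbrakk> \<Longrightarrow> t (bar a) a x = x"
    and bar_right: "\<lbrakk>a \<in> A; x \<in> A\<rbrakk> \<Longrightarrow> t x a (bar a) = x"
    and square_right: "\<lbrakk>a \<in> A; b \<in> A\<rbrakk> \<Longrightarrow> t a b b = bar a"
begin

text \<open>Two evaluations of \<open>t (bar a) a a\<close>.\<close>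

lemma bar_bar: "a \<in> A \<Longrightarrow> bar (bar a) = a"
  using square_right[of "bar a" a] by (simp add: bar_closed bar_left)

lemma bar_left': "\<lbrakk>a \<in> A; x \<in> A\<rbrakk> \<Longrightarrow> t a (bar a) x = x"
  using bar_left[of "bar a" x] by (simp add: bar_closed bar_bar)

lemma bar_right': "\<lbrakk>a \<in> A; x \<in> A\<rbrakk> \<Longrightarrow> t x (bar a) a = x"
  using bar_right[of "bar a" x] by (simp add: bar_closed bar_bar)

lemmas bar_simps = bar_closed bar_left bar_right bar_left' bar_right'

text \<open>The array has rows \<open>a, d, bar d\<close>, then \<open>b, c, d\<close>, then
  \<open>c, bar c, e\<close>. The first and last rows collapse to \<open>a\<close> and
  \<open>e\<close>, the last two columns to \<open>d\<close> and \<open>e\<close>.\<close>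

lemma left_middle:
  assumes "a \<in> A" "b \<in> A" "c \<in> A" "d \<in> A" "e \<in> A"
  shows "t (t a b c) d e = t a (t b c d) e"
  using entropic[of a d "bar d" b c d c "bar c" e] assms by (simp add: bar_simps)

lemma middle_right:
  assumes "a \<in> A" "b \<in> A" "c \<in> A" "d \<in> A" "e \<in> A"
  shows "t a (t b c d) e = t a b (t c d e)"
  using entropic[of a "bar c" c b c d "bar b" b e] assms by (simp add: bar_simps)

text \<open>The rows of the array collapse to \<open>x\<close>, \<open>y\<close>, \<open>z\<close>
  and its columns to \<open>z\<close>, \<open>y\<close>, \<open>x\<close>.\<close>

lemma reversal:
  assumes "x \<in> A" "y \<in> A" "z \<in> A"
  shows "t x y z = t z y x"
  using entropic[of "bar y" y x y "bar y" y z y "bar y"] assms by (simp add: bar_simps)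

lemma knot_theoretic: "knot_theoretic_ternary_group A t"
proof unfold_locales
  have square_left: "t c c d = bar d" if "c \<in> A" "d \<in> A" for c d
    using that by (simp add: reversal[of c c d] square_right)
  fix a b c assume A: "a \<in> A" "b \<in> A" "c \<in> A"
  show "\<exists>!z. z \<in> A \<and> t z a b = c"
  \<comment> \<open>All three witnesses arise by cancelling the known factors with their skew
    elements, on the side where they stand.\<close>
  proof (rule ex1I[of _ "t c (bar b) (bar a)"])
    show "t c (bar b) (bar a) \<in> A \<and> t (t c (bar b) (bar a)) a b = c"
      using A by (simp add: closed left_middle middle_right bar_simps)
  next
    fix z assume "z \<in> A \<and> t z a b = c"
    then show "z = t c (bar b) (bar a)"
      using A left_middle[of z a b "bar b" "bar a"] by (simp add: bar_simps)
  qed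
  show "\<exists>!z. z \<in> A \<and> t a z b = c"
  proof (rule ex1I[of _ "t (bar a) c (bar b)"])
    show "t (bar a) c (bar b) \<in> A \<and> t a (t (bar a) c (bar b)) b = c"
      using A by (simp add: closed middle_right bar_simps)
  next
    fix z assume "z \<in> A \<and> t a z b = c"
    then show "z = t (bar a) c (bar b)"
      using A middle_right[of "bar a" a z b "bar b"] by (auto simp: bar_simps)
  qed
  show "\<exists>!z. z \<in> A \<and> t a b z = c"
  proof (rule ex1I[of _ "t (bar b) (bar a) c"])
    show "t (bar b) (bar a) c \<in> A \<and> t a b (t (bar b) (bar a) c) = c"
      using A by (simp add: closed middle_right[symmetric] bar_simps)
  next
    fix z assume "z \<in> A \<and> t a b z = c"
    then show "z = t (bar b) (bar a) c"
      using A middle_right[of "bar b" "bar a" a b z] by (auto simp: bar_simps)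
  qed
  fix d assume d: "d \<in> A"
  show "t (t a b c) c d = t (t a b (t b c d)) (t b c d) d"
  proof -
    have "t (t a b c) c d = t a b (t c c d)"
      "t (t a b (t b c d)) (t b c d) d = t a b (t (t b c d) (t b c d) d)"
      using A d by (simp_all only: left_middle middle_right closed)
    then show ?thesis
      using A d by (simp add: square_left closed)
  qed
  \<comment> \<open>Regrouping exposes a square after \<open>a\<close> on each side; by
    \<open>square_right\<close> both are \<open>bar a\<close>, whatever is squared.\<close>
  have "t a b (t b c d) = t (t a b b) c d"
    "t a (t a b c) (t (t a b c) c d) = t (t a (t a b c) (t a b c)) c d"
    using A d by (simp_all only: left_middle middle_right closed)
  then show "t a b (t b c d) = t a (t a b c) (t (t a b c) c d)"
    using A d by (simp add: square_right closed)
qed (auto simp: left_middle middle_right)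

end

theorem theorem5p4:
  fixes A :: "'a set" and t :: "'a \<Rightarrow> 'a \<Rightarrow> 'a \<Rightarrow> 'a"
  assumes "ternary_groupoid A t"
  shows "knot_theoretic_ternary_group A t \<longleftrightarrow>
    entropic_ternary_groupoid A t \<and>
    (\<exists>bar :: 'a \<Rightarrow> 'a. (\<forall>a\<in>A. bar a \<in> A) \<and>
      (\<forall>a\<in>A. \<forall>b\<in>A. \<forall>x\<in>A.
        t (bar a) a x = x \<and> t x a (bar a) = x \<and> t a b b = bar a))"
proof
  assume "knot_theoretic_ternary_group A t"
  then interpret knot_theoretic_ternary_group A t .
  \<comment> \<open>As \<open>t a b b\<close> does not depend on \<open>b\<close>, the choice
    \<open>b = a\<close> gives an explicit skew operation.\<close>
  have "\<forall>a\<in>A. \<forall>b\<in>A. \<forall>x\<in>A. t (t a a a) a x = x \<and> t x a (t a a a) = x \<and> t a b b = t a a a"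
    using square_skew right_square_const by blast
  moreover have "\<forall>a\<in>A. t a a a \<in> A"
    using closed by blast
  moreover have "entropic_ternary_groupoid A t"
    by (rule entropic_if_semicommutative) (rule semicommutative)
  ultimately show "entropic_ternary_groupoid A t \<and>
    (\<exists>bar :: 'a \<Rightarrow> 'a. (\<forall>a\<in>A. bar a \<in> A) \<and>
      (\<forall>a\<in>A. \<forall>b\<in>A. \<forall>x\<in>A.
        t (bar a) a x = x \<and> t x a (bar a) = x \<and> t a b b = bar a))"
    by (intro conjI exI[of _ "\<lambda>a. t a a a"])
next
  assume "entropic_ternary_groupoid A t \<and>
    (\<exists>bar :: 'a \<Rightarrow> 'a. (\<forall>a\<in>A. bar a \<in> A) \<and>
      (\<forall>a\<in>A. \<forall>b\<in>A. \<forall>x\<in>A.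
        t (bar a) a x = x \<and> t x a (bar a) = x \<and> t a b b = bar a))"
  then obtain bar :: "'a \<Rightarrow> 'a" where "entropic_ternary_groupoid A t"
    and "\<forall>a\<in>A. bar a \<in> A"
    and "\<forall>a\<in>A. \<forall>b\<in>A. \<forall>x\<in>A. t (bar a) a x = x \<and> t x a (bar a) = x \<and> t a b b = bar a"
    by blast
  then have "skew_entropic_ternary_groupoid A t bar"
    by (auto simp: skew_entropic_ternary_groupoid_def skew_entropic_ternary_groupoid_axioms_def)
  then show "knot_theoretic_ternary_group A t"
    by (rule skew_entropic_ternary_groupoid.knot_theoretic)
qed

end
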